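(* Let $n\geq 1$, $q\geq 2$ and $s\geq 0$ be integers. For each $1\leq i\leq n$ let $A_i\subseteq \mathbb{R}$ be a subset with $|A_i|=q$, and consider the box $\mathcal{B}:=\prod_{i=1}^n A_i\subseteq \mathbb{R}^n$. Suppose that $\mathcal{F}\subseteq \mathcal{B}$ is a set such that $|d(\mathcal{F})|\leq s$. Then $$ |\mathcal{F}|\leq 2\cdot \Big|\Big\{x_1^{\alpha_1}\cdots x_n^{\alpha_n}:~ 0\leq \alpha_i \leq q-1 \text{ for each } 1\le i\le n,\ \sum_{i=1}^n \alpha_i \leq s \Big\}\Big|, $$ where the set on the right is a set of monomials in the variables $x_1,\dots,x_n$ with integer exponents $\alpha_i$.
   Context: For a set $\mathcal{G}\subseteq\mathbb{R}^n$, $d(\mathcal{G})$ denotes the set of non-zero Euclidean distances among points of $\mathcal{G}$: $d(\mathcal{G}):=\{d(\mathbf{p}_1,\mathbf{p}_2): \mathbf{p}_1,\mathbf{p}_2\in\mathcal{G},\ \mathbf{p}_1\neq\mathbf{p}_2\}$, where $d(\mathbf{p}_1,\mathbf{p}_2)$ is the Euclidean distance. *)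

theory Defs
  imports "HOL-Analysis.Analysis" "HOL-Library.Poly_Mapping"
begin

definition distance_set :: "(real ^ 'n) set \<Rightarrow> real set" where
  "distance_set G = {dist p1 p2 | p1 p2. p1 \<in> G \<and> p2 \<in> G \<and> p1 \<noteq> p2}"

definition box_prod :: "('n \<Rightarrow> real set) \<Rightarrow> (real ^ 'n) set" where
  "box_prod A = {x. \<forall>i. x $ i \<in> A i}"

text \<open>Multivariate polynomials over the reals in variables indexed by \<open>'n\<close> are finitely
  supported maps from exponent vectors to coefficients; multiplication is convolution.\<close>

type_synonym 'n mpoly_real = "('n \<Rightarrow>\<^sub>0 nat) \<Rightarrow>\<^sub>0 real"

definition Var :: "'n \<Rightarrow> 'n mpoly_real" where
  "Var i = Poly_Mapping.single (Poly_Mapping.single i 1) 1"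

definition bounded_monomials :: "nat \<Rightarrow> nat \<Rightarrow> ('n :: finite) mpoly_real set" where
  "bounded_monomials q s =
     {(\<Prod>i\<in>UNIV. Var i ^ \<alpha> i) | \<alpha> :: 'n \<Rightarrow> nat.
        (\<forall>i. 0 \<le> \<alpha> i \<and> \<alpha> i \<le> q - 1) \<and> (\<Sum>i\<in>UNIV. \<alpha> i) \<le> s}"

end

theory Submission
  imports Defs
begin

text \<open>
  A system of linear equations with fewer equations than unknowns has a nontrivial solution. Hence,
  if \<open>F\<close> had more points than there are reduced monomials of degree at most \<open>s\<close>, some nonzero
  weight \<open>w\<close> on \<open>F\<close> would be orthogonal to all these monomials, and then to all monomials of degree
  at most \<open>s\<close>, because on the box a power \<open>x\<^sub>i\<^sup>q\<close> reduces to lower powers of \<open>x\<^sub>i\<close>.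
  The polynomial \<open>P(x, y) = \<Prod>\<^sub>d (d\<^sup>2 - |x - y|\<^sup>2)\<close> over the distances \<open>d\<close> of \<open>F\<close> has degree at most
  \<open>2s\<close>, so each of its monomials has degree at most \<open>s\<close> in \<open>x\<close> or in \<open>y\<close>, whence
  \<open>\<Sum>\<^sub>x \<Sum>\<^sub>y w(x) w(y) P(x, y) = 0\<close>. But \<open>P\<close> vanishes off the diagonal of \<open>F \<times> F\<close> and is a positive
  constant on it, so \<open>w = 0\<close>. This even gives the bound without the factor 2.
\<close>

section \<open>Linear algebra: underdetermined homogeneous systems\<close>

text \<open>Gaussian elimination, one equation per induction step: an equation with all coefficients
  zero is dropped, any other one is used to eliminate an unknown.\<close>

lemma homogeneous_system_nontrivial_solution:
  fixes f :: "'i \<Rightarrow> 'a \<Rightarrow> real"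
  assumes "finite I" "finite X" "card I < card X"
  shows "\<exists>w. (\<exists>x\<in>X. w x \<noteq> 0) \<and> (\<forall>i\<in>I. (\<Sum>x\<in>X. w x * f i x) = 0)"
  using assms
proof (induction I arbitrary: X f rule: finite_induct)
  case empty
  then have "X \<noteq> {}" by auto
  then show ?case by (intro exI[of _ "\<lambda>_. 1"]) auto
next
  case (insert i I)
  show ?case
  proof (cases "\<forall>x\<in>X. f i x = 0")
    case True
    have "card I < card X" using insert by simp
    with insert.IH[OF insert.prems(1), of f] True show ?thesis by auto
  next
    case False
    then obtain z where z: "z \<in> X" "f i z \<noteq> 0" by blast
    define X' where "X' = X - {z}"
    have X': "finite X'" "z \<notin> X'" "X = insert z X'" using z insert.prems by (auto simp: X'_def)
    have "card I < card X'" using insert.prems insert.hyps X' by simp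
    \<comment> \<open>With pivot \<open>f i z\<close>, subtracting \<open>f j z / f i z\<close>
      times equation \<open>i\<close> removes the unknown at \<open>z\<close> from equation
      \<open>j\<close>.\<close>
    from insert.IH[OF X'(1) this, of "\<lambda>j x. f j x - f j z * f i x / f i z"]
    obtain w where w: "\<exists>x\<in>X'. w x \<noteq> 0"
      "\<And>j. j \<in> I \<Longrightarrow> (\<Sum>x\<in>X'. w x * (f j x - f j z * f i x / f i z)) = 0" by blast
    \<comment> \<open>Back substitution: this value at \<open>z\<close> solves equation
      \<open>i\<close>.\<close>
    define c where "c = - (\<Sum>x\<in>X'. w x * f i x) / f i z"
    define v where "v = w(z := c)"
    have v: "(\<Sum>x\<in>X. v x * f j x) = c * f j z + (\<Sum>x\<in>X'. w x * f j x)" for j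
    proof -
      have "(\<Sum>x\<in>X'. v x * f j x) = (\<Sum>x\<in>X'. w x * f j x)"
        by (rule sum.cong) (use X' in \<open>auto simp: v_def\<close>)
      then show ?thesis using X' by (simp add: v_def)
    qed
    have "(\<Sum>x\<in>X. v x * f j x) = 0" if "j \<in> insert i I" for j
    proof (cases "j = i")
      case True
      then show ?thesis using z v[of i] by (simp add: c_def)
    next
      case False
      then have "0 = (\<Sum>x\<in>X'. w x * (f j x - f j z * f i x / f i z))" using w(2) that by simp
      also have "\<dots> = (\<Sum>x\<in>X'. w x * f j x) - (\<Sum>x\<in>X'. f j z / f i z * (w x * f i x))"
        unfolding sum_subtractf[symmetric] by (rule sum.cong) (auto simp: algebra_simps)
      also have "\<dots> = (\<Sum>x\<in>X. v x * f j x)"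
        unfolding v c_def sum_distrib_left[symmetric] by simp
      finally show ?thesis by simp
    qed
    moreover have "\<exists>x\<in>X. v x \<noteq> 0" using w(1) X' by (auto simp: v_def)
    ultimately show ?thesis by blast
  qed
qed

section \<open>Monomials as functions and their reduction on the box\<close>

definition monomial_at :: "('n::finite \<Rightarrow> nat) \<Rightarrow> real ^ 'n \<Rightarrow> real" where
  "monomial_at \<alpha> x = (\<Prod>i\<in>UNIV. x $ i ^ \<alpha> i)"

lemma monomial_at_add_exponent:
  "monomial_at (\<alpha>(i := \<alpha> i + k)) x = monomial_at \<alpha> x * x $ i ^ k"
proof -
  have "(\<Prod>j\<in>UNIV - {i}. x $ j ^ (\<alpha>(i := \<alpha> i + k)) j) = (\<Prod>j\<in>UNIV - {i}. x $ j ^ \<alpha> j)"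
    by (rule prod.cong) auto
  then show ?thesis
    unfolding monomial_at_def by (simp add: prod.remove[of UNIV i] power_add)
qed

lemma sum_add_exponent:
  fixes \<alpha> :: "'n::finite \<Rightarrow> nat"
  shows "(\<Sum>j\<in>UNIV. (\<alpha>(i := \<alpha> i + k)) j) = (\<Sum>j\<in>UNIV. \<alpha> j) + k"
proof -
  have "(\<Sum>j\<in>UNIV - {i}. (\<alpha>(i := \<alpha> i + k)) j) = (\<Sum>j\<in>UNIV - {i}. \<alpha> j)"
    by (rule sum.cong) auto
  then show ?thesis by (simp add: sum.remove[of UNIV i])
qed

text \<open>The product of all \<open>x - a\<close> with \<open>a\<close> in \<open>A\<close> is
  monic of degree \<open>card A\<close> and vanishes on \<open>A\<close>; solve for its leading
  term.\<close>

lemma power_card_reduction: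
  fixes A :: "'a::idom set"
  assumes "finite A"
  obtains c where "\<And>x. x \<in> A \<Longrightarrow> x ^ card A = (\<Sum>j<card A. c j * x ^ j)"
proof -
  define p where "p = (\<Prod>a\<in>A. [:-a, 1:])"
  have deg: "degree p = card A"
    unfolding p_def by (subst degree_prod_eq_sum_degree) auto
  have lead: "coeff p (card A) = 1"
    unfolding deg[symmetric] unfolding p_def by (simp add: lead_coeff_prod)
  show thesis
  proof (rule that[of "\<lambda>j. - coeff p j"])
    fix x assume "x \<in> A"
    then have "poly p x = 0" using assms by (auto simp: p_def poly_prod)
    then have "(\<Sum>j<card A. coeff p j * x ^ j) + x ^ card A = 0"
      by (simp add: poly_altdef deg lead lessThan_Suc_atMost[symmetric])
    then show "x ^ card A = (\<Sum>j<card A. - coeff p j * x ^ j)"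
      by (simp add: sum_negf eq_neg_iff_add_eq_0 add.commute)
  qed
qed

lemma orthogonal_monomials_from_reduced:
  fixes w :: "real ^ 'n::finite \<Rightarrow> real"
  assumes A: "\<And>i. finite (A i)" "\<And>i. card (A i) = q"
    and F: "F \<subseteq> box_prod A"
    and reduced: "\<And>\<alpha>. (\<forall>i. \<alpha> i < q) \<Longrightarrow> (\<Sum>i\<in>UNIV. \<alpha> i) \<le> s \<Longrightarrow>
      (\<Sum>x\<in>F. w x * monomial_at \<alpha> x) = 0"
    and "(\<Sum>i\<in>UNIV. \<alpha> i) \<le> s"
  shows "(\<Sum>x\<in>F. w x * monomial_at \<alpha> x) = 0"
  using assms(5)
proof (induction "\<Sum>i\<in>UNIV. \<alpha> i" arbitrary: \<alpha> rule: less_induct)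
  case less
  show ?case
  proof (cases "\<forall>i. \<alpha> i < q")
    case True
    then show ?thesis using reduced less.prems by blast
  next
    case False
    then obtain i where i: "q \<le> \<alpha> i" by (auto simp: not_less)
    obtain c where c: "\<And>t. t \<in> A i \<Longrightarrow> t ^ q = (\<Sum>j<q. c j * t ^ j)"
      using power_card_reduction[OF A(1)[of i]] A(2)[of i] by metis
    \<comment> \<open>Stripping \<open>q\<close> from exponent \<open>i\<close> leaves a common
      base: adding back \<open>q\<close> gives \<alpha>, adding back \<open>j < q\<close> gives the
      terms that replace it, all of smaller total degree.\<close>
    define \<beta> where "\<beta> = \<alpha>(i := \<alpha> i - q)"
    have \<alpha>: "\<alpha> = \<beta>(i := \<beta> i + q)" using i by (auto simp: \<beta>_def)
    have deg: "(\<Sum>k\<in>UNIV. \<alpha> k) = (\<Sum>k\<in>UNIV. \<beta> k) + q"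
      by (subst \<alpha>) (rule sum_add_exponent)
    have zero: "(\<Sum>x\<in>F. w x * monomial_at (\<beta>(i := \<beta> i + j)) x) = 0" if "j < q" for j
      by (rule less.hyps; subst sum_add_exponent) (use that deg less.prems in auto)
    have "(\<Sum>x\<in>F. w x * monomial_at \<alpha> x)
        = (\<Sum>x\<in>F. \<Sum>j<q. c j * (w x * monomial_at (\<beta>(i := \<beta> i + j)) x))"
    proof (rule sum.cong[OF refl])
      fix x assume "x \<in> F"
      then have "x $ i \<in> A i" using F by (auto simp: box_prod_def)
      have "monomial_at \<alpha> x = monomial_at \<beta> x * x $ i ^ q"
        by (subst \<alpha>) (rule monomial_at_add_exponent)
      also have "\<dots> = (\<Sum>j<q. c j * (monomial_at \<beta> x * x $ i ^ j))"
        by (simp add: c[OF \<open>x $ i \<in> A i\<close>] sum_distrib_left mult_ac)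
      also have "\<dots> = (\<Sum>j<q. c j * monomial_at (\<beta>(i := \<beta> i + j)) x)"
        by (simp only: monomial_at_add_exponent)
      finally show "w x * monomial_at \<alpha> x
          = (\<Sum>j<q. c j * (w x * monomial_at (\<beta>(i := \<beta> i + j)) x))"
        by (simp add: sum_distrib_left mult_ac)
    qed
    also have "\<dots> = (\<Sum>j<q. c j * (\<Sum>x\<in>F. w x * monomial_at (\<beta>(i := \<beta> i + j)) x))"
      by (subst sum.swap) (simp only: sum_distrib_left)
    also have "\<dots> = 0" by (rule sum.neutral) (use zero in auto)
    finally show ?thesis .
  qed
qed

section \<open>The product over the distances, paired with the weight in both variables\<close>

lemma dist_power2_expand:
  fixes x y :: "real ^ 'n::finite"
  shows "(dist x y)\<^sup>2 = (\<Sum>i\<in>UNIV. (x $ i)\<^sup>2 - 2 * (x $ i * y $ i) + (y $ i)\<^sup>2)"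
proof -
  have "(dist x y)\<^sup>2 = (\<Sum>i\<in>UNIV. (x $ i - y $ i)\<^sup>2)"
    by (simp add: dist_vec_def L2_set_def sum_nonneg dist_real_def)
  then show ?thesis by (simp add: power2_diff algebra_simps)
qed

text \<open>The factor \<open>x\<^sup>\<alpha> y\<^sup>\<beta>\<close> makes the induction over \<open>D\<close> go through: expanding one factor of the
  product produces such terms with total degree larger by at most two.\<close>

lemma orthogonal_distance_product:
  fixes w :: "real ^ 'n::finite \<Rightarrow> real"
  assumes orth: "\<And>\<alpha>. (\<Sum>i\<in>UNIV. \<alpha> i) \<le> s \<Longrightarrow> (\<Sum>x\<in>F. w x * monomial_at \<alpha> x) = 0"
    and "finite D"
    and "(\<Sum>i\<in>UNIV. \<alpha> i) + (\<Sum>i\<in>UNIV. \<beta> i) + 2 * card D \<le> 2 * s + 1"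
  shows "(\<Sum>x\<in>F. \<Sum>y\<in>F. w x * w y *
    (monomial_at \<alpha> x * monomial_at \<beta> y * (\<Prod>d\<in>D. d\<^sup>2 - (dist x y)\<^sup>2))) = 0"
  using assms(2,3)
proof (induction D arbitrary: \<alpha> \<beta> rule: finite_induct)
  case empty
  have "(\<Sum>x\<in>F. \<Sum>y\<in>F. w x * w y * (monomial_at \<alpha> x * monomial_at \<beta> y))
      = (\<Sum>x\<in>F. w x * monomial_at \<alpha> x) * (\<Sum>y\<in>F. w y * monomial_at \<beta> y)"
    by (simp add: sum_product mult_ac)
  \<comment> \<open>Two degrees of at least \<open>s + 1\<close> would sum to
    \<open>2 * s + 2\<close>, beyond the allowed \<open>2 * s + 1\<close>.\<close>
  moreover have "(\<Sum>i\<in>UNIV. \<alpha> i) \<le> s \<or> (\<Sum>i\<in>UNIV. \<beta> i) \<le> s" using empty by auto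
  ultimately show ?case using orth by auto
next
  case (insert e D)
  define T where "T \<alpha> \<beta> x y = w x * w y *
    (monomial_at \<alpha> x * monomial_at \<beta> y * (\<Prod>d\<in>D. d\<^sup>2 - (dist x y)\<^sup>2))" for \<alpha> \<beta> x y
  define up where "up \<gamma> i k = \<gamma>(i := \<gamma> i + k)" for \<gamma> :: "'n \<Rightarrow> nat" and i k
  \<comment> \<open>Removing \<open>e\<close> lowers \<open>2 * card D\<close> by two, which pays
    for two extra degrees in the monomials.\<close>
  have T: "(\<Sum>x\<in>F. \<Sum>y\<in>F. T \<gamma> \<delta> x y) = 0"
    if "(\<Sum>i\<in>UNIV. \<gamma> i) + (\<Sum>i\<in>UNIV. \<delta> i) \<le> (\<Sum>i\<in>UNIV. \<alpha> i) + (\<Sum>i\<in>UNIV. \<beta> i) + 2" for \<gamma> \<delta>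
    unfolding T_def by (rule insert.IH) (use that insert.prems insert.hyps in simp)
  have deg: "(\<Sum>j\<in>UNIV. up \<gamma> i k j) = (\<Sum>j\<in>UNIV. \<gamma> j) + k" for \<gamma> i k
    unfolding up_def by (rule sum_add_exponent)
  \<comment> \<open>The factor of \<open>e\<close> is expanded by coordinates; \<open>up\<close>
    absorbs the squares and mixed products into the exponents.\<close>
  have "w x * w y * (monomial_at \<alpha> x * monomial_at \<beta> y * (\<Prod>d\<in>insert e D. d\<^sup>2 - (dist x y)\<^sup>2))
      = e\<^sup>2 * T \<alpha> \<beta> x y - (\<Sum>i\<in>UNIV. T (up \<alpha> i 2) \<beta> x y - 2 * T (up \<alpha> i 1) (up \<beta> i 1) x y
          + T \<alpha> (up \<beta> i 2) x y)" for x y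
  proof -
    have "w x * w y * (monomial_at \<alpha> x * monomial_at \<beta> y * (\<Prod>d\<in>insert e D. d\<^sup>2 - (dist x y)\<^sup>2))
        = e\<^sup>2 * T \<alpha> \<beta> x y - (dist x y)\<^sup>2 * T \<alpha> \<beta> x y"
      using insert.hyps by (simp add: T_def algebra_simps)
    also have "(dist x y)\<^sup>2 * T \<alpha> \<beta> x y = (\<Sum>i\<in>UNIV. T (up \<alpha> i 2) \<beta> x y
        - 2 * T (up \<alpha> i 1) (up \<beta> i 1) x y + T \<alpha> (up \<beta> i 2) x y)"
      unfolding dist_power2_expand[of x y] sum_distrib_right
      unfolding T_def up_def monomial_at_add_exponent
      by (intro sum.cong refl) (simp add: algebra_simps)
    finally show ?thesis .
  qed
  then have "(\<Sum>x\<in>F. \<Sum>y\<in>F. w x * w y *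
      (monomial_at \<alpha> x * monomial_at \<beta> y * (\<Prod>d\<in>insert e D. d\<^sup>2 - (dist x y)\<^sup>2)))
      = (\<Sum>x\<in>F. \<Sum>y\<in>F. e\<^sup>2 * T \<alpha> \<beta> x y - (\<Sum>i\<in>UNIV. T (up \<alpha> i 2) \<beta> x y
          - 2 * T (up \<alpha> i 1) (up \<beta> i 1) x y + T \<alpha> (up \<beta> i 2) x y))"
    by presburger
  also have "\<dots> = e\<^sup>2 * (\<Sum>x\<in>F. \<Sum>y\<in>F. T \<alpha> \<beta> x y)
      - (\<Sum>x\<in>F. \<Sum>y\<in>F. \<Sum>i\<in>UNIV. T (up \<alpha> i 2) \<beta> x y
          - 2 * T (up \<alpha> i 1) (up \<beta> i 1) x y + T \<alpha> (up \<beta> i 2) x y)"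
    by (simp only: sum_subtractf sum_distrib_left)
  also have "(\<Sum>x\<in>F. \<Sum>y\<in>F. \<Sum>i\<in>UNIV. T (up \<alpha> i 2) \<beta> x y
          - 2 * T (up \<alpha> i 1) (up \<beta> i 1) x y + T \<alpha> (up \<beta> i 2) x y)
      = (\<Sum>i\<in>UNIV. \<Sum>x\<in>F. \<Sum>y\<in>F. T (up \<alpha> i 2) \<beta> x y
          - 2 * T (up \<alpha> i 1) (up \<beta> i 1) x y + T \<alpha> (up \<beta> i 2) x y)"
    by (simp only: sum.swap[of _ UNIV F])
  also have "\<dots> = (\<Sum>i\<in>UNIV. (\<Sum>x\<in>F. \<Sum>y\<in>F. T (up \<alpha> i 2) \<beta> x y)
          - 2 * (\<Sum>x\<in>F. \<Sum>y\<in>F. T (up \<alpha> i 1) (up \<beta> i 1) x y)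
          + (\<Sum>x\<in>F. \<Sum>y\<in>F. T \<alpha> (up \<beta> i 2) x y))"
    by (simp only: sum_subtractf sum.distrib sum_distrib_left)
  also have "\<dots> = 0"
    by (intro sum.neutral ballI) (simp add: T deg)
  finally show ?case by (simp add: T)
qed

section \<open>Counting monomials, finiteness of the box\<close>

text \<open>Each product of variable powers is a single term with coefficient 1, so its exponents
  can be read off and distinct exponent vectors give distinct monomials.\<close>

lemma card_bounded_monomials:
  assumes "q > 0"
  shows "card (bounded_monomials q s :: 'n::finite mpoly_real set)
    = card {\<alpha> :: 'n \<Rightarrow> nat. (\<forall>i. \<alpha> i < q) \<and> (\<Sum>i\<in>UNIV. \<alpha> i) \<le> s}"
proof -
  define m where "m \<alpha> = (\<Prod>i\<in>UNIV. Var i ^ \<alpha> i)" for \<alpha> :: "'n \<Rightarrow> nat"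
  have pow: "Var i ^ k = Poly_Mapping.single (Poly_Mapping.single i k) 1" for i :: 'n and k
    by (induction k) (simp_all add: Var_def mult_single single_add[symmetric])
  have prod: "(\<Prod>i\<in>I. Var i ^ \<alpha> i)
      = Poly_Mapping.single (\<Sum>i\<in>I. Poly_Mapping.single i (\<alpha> i)) 1"
    if "finite I" for \<alpha> and I :: "'n set"
    using that by (induction I rule: finite_induct) (simp_all add: pow mult_single)
  have "inj m"
  proof (rule injI)
    fix \<alpha> \<beta> assume "m \<alpha> = m \<beta>"
    then have eq: "(\<Sum>i\<in>UNIV. Poly_Mapping.single i (\<alpha> i)) = (\<Sum>i\<in>UNIV. Poly_Mapping.single i (\<beta> i))"
      unfolding m_def prod[OF finite] by (metis lookup_single_eq lookup_single_not_eq zero_neq_one)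
    have look: "Poly_Mapping.lookup (\<Sum>i\<in>UNIV. Poly_Mapping.single i (\<gamma> i)) j = \<gamma> j" for \<gamma> :: "'n \<Rightarrow> nat" and j
      by (simp add: lookup_sum lookup_single when_def)
    show "\<alpha> = \<beta>" using arg_cong[OF eq, of Poly_Mapping.lookup] by (intro ext) (metis look)
  qed
  moreover have "(bounded_monomials q s :: 'n mpoly_real set)
      = m ` {\<alpha>. (\<forall>i. \<alpha> i < q) \<and> (\<Sum>i\<in>UNIV. \<alpha> i) \<le> s}"
  proof -
    have "\<alpha> i \<le> q - 1 \<longleftrightarrow> \<alpha> i < q" for \<alpha> :: "'n \<Rightarrow> nat" and i using assms by auto
    then show ?thesis unfolding bounded_monomials_def m_def by auto
  qed
  ultimately show ?thesis by (simp add: card_image inj_on_subset[OF _ subset_UNIV])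
qed

lemma finite_box_prod:
  fixes A :: "'n::finite \<Rightarrow> real set"
  assumes "\<And>i. finite (A i)"
  shows "finite (box_prod A)"
proof -
  have "finite (Pi\<^sub>E UNIV A)" using assms by (intro finite_PiE) auto
  then have "finite {f. \<forall>i. f i \<in> A i}" by (simp add: PiE_UNIV_domain Pi_def)
  then have "finite (vec_lambda ` {f. \<forall>i. f i \<in> A i})" by simp
  moreover have "box_prod A \<subseteq> vec_lambda ` {f. \<forall>i. f i \<in> A i}"
  proof
    fix x assume "x \<in> box_prod A"
    then show "x \<in> vec_lambda ` {f. \<forall>i. f i \<in> A i}"
      by (intro image_eqI[of _ _ "vec_nth x"]) (auto simp: box_prod_def)
  qed
  ultimately show ?thesis by (rule finite_subset[rotated])
qed

section \<open>The bound on \<open>F\<close>\<close>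

theorem theorem1p4:
  fixes q s :: nat
    and A :: "'n::finite \<Rightarrow> real set"
    and F :: "(real ^ 'n) set"
  assumes "q \<ge> 2"
    and "\<And>i. card (A i) = q"
    and "F \<subseteq> box_prod A"
    and "card (distance_set F) \<le> s"
  shows "card F \<le> 2 * card (bounded_monomials q s :: 'n mpoly_real set)"
proof -
  define E where "E = {\<alpha> :: 'n \<Rightarrow> nat. (\<forall>i. \<alpha> i < q) \<and> (\<Sum>i\<in>UNIV. \<alpha> i) \<le> s}"
  \<comment> \<open>Infinite sets have \<open>card\<close> 0, which \<open>q \<ge> 2\<close>
    excludes.\<close>
  have finA: "finite (A i)" for i
    by (rule card_ge_0_finite) (use assms(1) assms(2)[of i] in simp)
  have finF: "finite F" using finite_box_prod[of A] finA assms(3) finite_subset by blast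
  have finE: "finite E"
  proof (rule finite_subset)
    show "E \<subseteq> Pi\<^sub>E UNIV (\<lambda>_. {..<q})" by (auto simp: E_def)
    show "finite (Pi\<^sub>E (UNIV :: 'n set) (\<lambda>_. {..<q}))" by (intro finite_PiE) auto
  qed
  have "card F \<le> card E"
  proof (rule ccontr)
    assume "\<not> card F \<le> card E"
    then obtain w where w: "\<exists>x\<in>F. w x \<noteq> 0"
      and orthE: "\<And>\<alpha>. \<alpha> \<in> E \<Longrightarrow> (\<Sum>x\<in>F. w x * monomial_at \<alpha> x) = 0"
      using homogeneous_system_nontrivial_solution[OF finE finF, of monomial_at] by auto
    have orth: "(\<Sum>x\<in>F. w x * monomial_at \<alpha> x) = 0" if "(\<Sum>i\<in>UNIV. \<alpha> i) \<le> s" for \<alpha>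
      by (rule orthogonal_monomials_from_reduced[OF finA assms(2,3) _ that])
        (use orthE in \<open>auto simp: E_def\<close>)
    define D where "D = distance_set F"
    have D_eq: "D = (\<lambda>(x, y). dist x y) ` {(x, y) \<in> F \<times> F. x \<noteq> y}"
      unfolding D_def distance_set_def by auto
    have finD: "finite D" unfolding D_eq
      by (intro finite_imageI finite_subset[OF _ finite_cartesian_product[OF finF finF]]) auto
    define c where "c = (\<Prod>d\<in>D. d\<^sup>2)"
    \<comment> \<open>Only distinct points contribute to \<open>D\<close>, so every factor is a
      nonzero square.\<close>
    have "c > 0" unfolding c_def by (rule prod_pos) (auto simp: D_eq)
    have diag: "(\<Prod>d\<in>D. d\<^sup>2 - (dist x y)\<^sup>2) = (if x = y then c else 0)" if "x \<in> F" "y \<in> F" for x y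
    proof (cases "x = y")
      case False
      then have "dist x y \<in> D" using that by (auto simp: D_eq)
      then show ?thesis using False finD by (auto intro!: prod_zero)
    qed (simp add: c_def)
    \<comment> \<open>Zero exponents give the bare product, and the degree condition becomes
      \<open>2 * card D \<le> 2 * s + 1\<close>.\<close>
    have "(\<Sum>x\<in>F. \<Sum>y\<in>F. w x * w y *
        (monomial_at (\<lambda>_. 0) x * monomial_at (\<lambda>_. 0) y * (\<Prod>d\<in>D. d\<^sup>2 - (dist x y)\<^sup>2))) = 0"
      by (rule orthogonal_distance_product[OF orth finD])
        (use assms(4) in \<open>auto simp: D_def\<close>)
    then have "0 = (\<Sum>x\<in>F. \<Sum>y\<in>F. w x * w y * (\<Prod>d\<in>D. d\<^sup>2 - (dist x y)\<^sup>2))"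
      by (simp add: monomial_at_def)
    also have "\<dots> = (\<Sum>x\<in>F. \<Sum>y\<in>F. if x = y then c * (w x)\<^sup>2 else 0)"
      by (intro sum.cong refl) (simp add: diag power2_eq_square[of "w _"])
    also have "\<dots> = (\<Sum>x\<in>F. c * (w x)\<^sup>2)" using finF by simp
    finally have "\<forall>x\<in>F. c * (w x)\<^sup>2 = 0"
      using \<open>c > 0\<close> finF by (subst sum_nonneg_eq_0_iff[symmetric]) auto
    then show False using w \<open>c > 0\<close> by auto
  qed
  also have "card E = card (bounded_monomials q s :: 'n mpoly_real set)"
    unfolding E_def by (rule card_bounded_monomials[symmetric]) (use assms(1) in simp)
  finally show ?thesis by simp
qed

end
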